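(* For every $(p,q)\in(\mathbb{N}^* )^2$, the sequence $\left(w_{p,q}^{(n)}\right)_{n\in\mathbb{N}}$ defined by $w_{p,q}^{(n)}=S_{p,q}^{(n)}+(-1)^{n+1}\rho_{p,q,n}^{(n)}$ converges linearly to $S_{p,q}$, with a rate of linear convergence $\chi_{p,q}$ such that $$\frac{1}{9e^2}<\chi_{p,q}<\frac{1}{4e^2}.$$
   Context: $\mathbb{N}^*$ denotes the positive integers and $\mathbb{N}$ the nonnegative integers. For $(p,q)\in(\mathbb{N}^* )^2$ and $n\in\mathbb{N}$, put $S_{p,q}=\sum_{k=0}^{+\infty}\frac{(-1)^k}{pk+q}$, $S_{p,q}^{(n)}=\sum_{k=0}^{n}\frac{(-1)^k}{pk+q}$, and $\alpha_{p,q}^{(n)}=2pn+p+2q$. For $m\in\mathbb{N}$, $\rho_{p,q,m}^{(n)}$ is the finite generalized continued fraction $$\rho_{p,q,m}^{(n)}=\cfrac{1}{\alpha+\cfrac{(1p)^2}{\alpha+\cfrac{(2p)^2}{\alpha+\cdots+\cfrac{(mp)^2}{\alpha}}}},\qquad \alpha=\alpha_{p,q}^{(n)},$$ with $\rho_{p,q,0}^{(n)}=1/\alpha_{p,q}^{(n)}$. A real sequence $(u_n)$ converging to $\ell$ has rate of convergence $V\in[0,1]$ if $\left|\frac{u_{n+1}-\ell}{u_n-\ell}\right|$ is defined and converges to $V$. It converges linearly if $V\in\,]0,1[$, and $V$ is then called its rate of linear convergence; in that case there exist $C>0$ and $k\in\,]0,1[$ with $|u_n-\ell|\le Ck^n$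 for all large $n$, and $V$ is the infimum of such $k$. *)

theory Defs
  imports Complex_Main
begin

definition S_partial :: "nat \<Rightarrow> nat \<Rightarrow> nat \<Rightarrow> real" where
  "S_partial p q n = (\<Sum>k=0..n. (-1) ^ k / real (p * k + q))"

definition S_series :: "nat \<Rightarrow> nat \<Rightarrow> real" where
  "S_series p q = (\<Sum>k. (-1) ^ k / real (p * k + q))"

(* The value of suminf is unspecified on divergent series; here the series converges. *)
lemma S_series_summable:
  assumes "p > 0" and "q > 0"
  shows "summable (\<lambda>k. (-1) ^ k / real (p * k + q))"
proof -
  have lim: "(\<lambda>k. 1 / real (p * k + q)) \<longlonglongrightarrow> 0"
  proof (rule tendsto_sandwich[OF _ _ tendsto_const LIMSEQ_inverse_real_of_nat])
    show "\<forall>\<^sub>F k in sequentially. 0 \<le> 1 / real (p * k + q)"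
      by simp
    have "Suc k \<le> p * k + q" for k
      using assms mult_le_mono1[of 1 p k] by linarith
    then have "real (Suc k) \<le> real (p * k + q)" for k
      by (simp only: of_nat_le_iff)
    then show "\<forall>\<^sub>F k in sequentially. 1 / real (p * k + q) \<le> inverse (real (Suc k))"
      by (intro always_eventually allI) (simp only: inverse_eq_divide frac_le zero_le_one
        of_nat_0_less_iff zero_less_Suc order_refl)
  qed
  have "monoseq (\<lambda>k. 1 / real (p * k + q))"
  proof (rule monoI2, intro allI impI)
    fix m n :: nat assume "m \<le> n"
    then have "real (p * m + q) \<le> real (p * n + q)"
      by (simp only: of_nat_le_iff add_le_mono1 mult_le_mono2)
    moreover have "0 < real (p * m + q)"
      using assms by (simp only: of_nat_0_less_iff add_pos_nonneg trans_less_add2)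
    ultimately show "1 / real (p * n + q) \<le> 1 / real (p * m + q)"
      by (intro frac_le) auto
  qed
  from summable_Leibniz(1)[OF lim this] show ?thesis
    by simp
qed

definition alpha :: "nat \<Rightarrow> nat \<Rightarrow> nat \<Rightarrow> real" where
  "alpha p q n = real (2 * p * n + p + 2 * q)"

(* cf_denom p a i r = a + ((i+1)p)^2 / (a + ((i+2)p)^2 / (... + ((i+r)p)^2 / a)) *)
primrec cf_denom :: "nat \<Rightarrow> real \<Rightarrow> nat \<Rightarrow> nat \<Rightarrow> real" where
  "cf_denom p a i 0 = a"
| "cf_denom p a i (Suc r) = a + (real (Suc i * p))\<^sup>2 / cf_denom p a (Suc i) r"

definition rho :: "nat \<Rightarrow> nat \<Rightarrow> nat \<Rightarrow> nat \<Rightarrow> real" where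
  "rho p q m n = 1 / cf_denom p (alpha p q n) 0 m"

definition w :: "nat \<Rightarrow> nat \<Rightarrow> nat \<Rightarrow> real" where
  "w p q n = S_partial p q n + (-1) ^ (n + 1) * rho p q n n"

(* The condition u n \<noteq> l says that the quotients are defined, since x / 0 = 0 here. *)
definition has_convergence_rate :: "(nat \<Rightarrow> real) \<Rightarrow> real \<Rightarrow> real \<Rightarrow> bool" where
  "has_convergence_rate u l V \<longleftrightarrow>
     u \<longlonglongrightarrow> l \<and> V \<in> {0..1} \<and> (\<forall>n. u n \<noteq> l) \<and>
     (\<lambda>n. \<bar>(u (Suc n) - l) / (u n - l)\<bar>) \<longlonglongrightarrow> V"

definition converges_linearly_with_rate :: "(nat \<Rightarrow> real) \<Rightarrow> real \<Rightarrow> real \<Rightarrow> bool" where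
  "converges_linearly_with_rate u l V \<longleftrightarrow> has_convergence_rate u l V \<and> V \<in> {0<..<1}"

end

theory Submission
  imports Defs "HOL-Analysis.Analysis"
begin

text \<open>
  Put \<open>s = q / p\<close> and \<open>x = n + s\<close>. The tail of the series after the \<open>n\<close>-th term is
  \<open>\<plusminus> J 0 x / p\<close> with \<open>J m x = \<integral>\<^sub>0\<^sup>1 t\<^sup>x (1 - t)\<^sup>m / (1 + t)\<^sup>m\<^sup>+\<^sup>1 dt\<close>. Integration by parts shows that
  \<open>(-1)\<^sup>m m! p\<^sup>m J m x\<close> satisfies the three-term recurrence of the continued fraction; let
  \<open>m! p\<^sup>m Q m x\<close> be its solution formed by the denominators of the convergents. Eliminating the
  continued fraction gives \<open>w n - S = - J (n + 1) x / (p * Q (n + 1) x)\<close>.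

  Contiguity relations in \<open>x\<close> turn the quotients \<open>J (n + 1) x / J n x\<close> and \<open>Q (n + 1) x / Q n x\<close>
  along \<open>x = n + s\<close> into orbits of Moebius maps whose coefficients converge. The limit map of the
  first contracts backwards to \<open>sqrt 2 - 1\<close>, that of the second forwards to \<open>sqrt 2 + 1\<close>, and
  the rate is \<open>(3 - 2 * sqrt 2) / (3 + 2 * sqrt 2) = 17 - 12 * sqrt 2\<close>.
\<close>

unbundle no vec_syntax  \<comment> \<open>it reserves \<open>\<chi>\<close> as a binder\<close>

section \<open>The integrals \<open>J m x\<close>: positivity, bounds and relations in
  \<open>m\<close> and in \<open>x\<close>\<close>

definition J_kernel :: "nat \<Rightarrow> real \<Rightarrow> real \<Rightarrow> real" where
  "J_kernel m x t = t powr x * ((1 - t) / (1 + t)) ^ m / (1 + t)"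

definition J :: "nat \<Rightarrow> real \<Rightarrow> real" where
  "J m x = integral {0..1} (J_kernel m x)"

lemma continuous_on_J_kernel:
  assumes "x > 0"
  shows "continuous_on {0..1} (J_kernel m x)"
  unfolding J_kernel_def using assms
  by (intro continuous_intros continuous_on_powr') auto

lemma J_kernel_integrable:
  assumes "x > 0"
  shows "J_kernel m x integrable_on {0..1}"
  using continuous_on_J_kernel[OF assms] by (rule integrable_continuous_real)

lemma J_kernel_nonneg:
  assumes "t \<in> {0..1}"
  shows "J_kernel m x t \<ge> 0"
  using assms unfolding J_kernel_def by auto

text \<open>A continuous nonnegative kernel with integral 0 would vanish on all of
  \<open>{0..1}\<close>, but this one is positive at \<open>1/2\<close>.\<close>

lemma J_pos:
  assumes "x > 0"
  shows "J m x > 0"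
proof -
  have "J_kernel m x (1/2) > 0"
    by (simp add: J_kernel_def)
  then have "J m x \<noteq> 0"
    unfolding J_def
    using integral_eq_0_iff[OF continuous_on_J_kernel[OF assms, of m]] J_kernel_nonneg
    by force
  moreover have "J m x \<ge> 0"
    unfolding J_def
    by (intro integral_nonneg J_kernel_integrable assms J_kernel_nonneg)
  ultimately show ?thesis
    by simp
qed

lemma J_decreasing:
  assumes "x > 0"
  shows "J (Suc m) x \<le> J m x"
  unfolding J_def
proof (intro integral_le J_kernel_integrable assms)
  fix t :: real assume t: "t \<in> {0..1}"
  have "((1 - t) / (1 + t)) ^ Suc m \<le> ((1 - t) / (1 + t)) ^ m"
    using t by (intro power_decreasing) (auto simp: divide_simps)
  then show "J_kernel (Suc m) x t \<le> J_kernel m x t"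
    unfolding J_kernel_def using t by (intro divide_right_mono mult_left_mono) auto
qed

text \<open>On \<open>{0..1}\<close> the kernel at \<open>x + 1\<close> is \<open>t\<close> times
  the kernel at \<open>x\<close>, so their sum loses the denominator \<open>1 + t\<close> and leaves
  \<open>t powr x\<close>.\<close>

lemma J_0_shift:
  assumes "x > 0"
  shows "J 0 x + J 0 (x + 1) = 1 / (x + 1)"
proof -
  have eq: "J_kernel 0 x t + J_kernel 0 (x + 1) t = t powr x" if "t \<in> {0..1}" for t
  proof -
    have "t powr (x + 1) = t powr x * t"
      using that by (simp add: powr_add)
    moreover have "1 + t > 0"
      using that by simp
    ultimately show ?thesis
      by (simp add: J_kernel_def divide_simps) (simp add: algebra_simps)
  qed
  have "J 0 x + J 0 (x + 1) = integral {0..1} (\<lambda>t. J_kernel 0 x t + J_kernel 0 (x + 1) t)"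
    unfolding J_def using assms by (subst integral_add) (auto intro: J_kernel_integrable)
  also have "\<dots> = integral {0..1} (\<lambda>t. t powr x)"
    by (intro integral_cong eq)
  also have "\<dots> = 1 / (x + 1)"
    using has_integral_powr_from_0[of x 1] assms by (intro integral_unique) simp
  finally show ?thesis .
qed

text \<open>The boundary value \<open>H 1 - H 0\<close> equals \<open>0 ^ m\<close>, which explains
  the exceptional right-hand side. At \<open>m = 0\<close> the truncated index \<open>m - 1\<close>
  is harmless, since its coefficient is 0.\<close>

lemma J_rec:
  assumes x: "x > 0"
  shows "(2 * x + 1) * J m x + real (m + 1) * J (Suc m) x - real m * J (m - 1) x
           = (if m = 0 then 1 else 0)"
proof -
  \<comment> \<open>\<open>f\<close> is the derivative of \<open>H\<close>: with \<open>r = (1 - t) / (1 + t)\<close> one has \<open>2 t / (1 + t) = 1 - r\<close>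
    and \<open>4 t / (1 + t)\<^sup>2 = 1 - r\<^sup>2\<close>.\<close>
  define H where "H t = 2 * (t powr (x + 1) * ((1 - t) / (1 + t)) ^ m / (1 + t))" for t :: real
  define f where "f t = (2 * x + 1) * J_kernel m x t + real (m + 1) * J_kernel (Suc m) x t
                         - real m * J_kernel (m - 1) x t" for t
  \<comment> \<open>The interior form of the fundamental theorem asks for the derivative only where
    \<open>t > 0\<close>, so \<open>powr\<close> is never differentiated at its base point
    0.\<close>
  have "(f has_integral (H 1 - H 0)) {0..1}"
  proof (rule fundamental_theorem_of_calculus_interior)
    show "continuous_on {0..1} H"
      unfolding H_def using x by (intro continuous_intros continuous_on_powr') auto
    fix t :: real assume t: "t \<in> {0<..<1}"
    define r where "r = (1 - t) / (1 + t)"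
    have t1: "1 + t > 0" "t > 0"
      using t by auto
    have "(H has_real_derivative
        2 * ((x + 1) * t powr x * r ^ m / (1 + t)
         + t powr (x + 1) * (real m * r ^ (m - 1) * (- 2 / (1 + t)\<^sup>2)) / (1 + t)
         - t powr (x + 1) * r ^ m / (1 + t)\<^sup>2)) (at t)"
      unfolding H_def r_def using t1
      apply (intro derivative_eq_intros)
                apply (auto simp: power2_eq_square)
      apply (simp add: divide_simps)
      done
    moreover have "2 * ((x + 1) * t powr x * r ^ m / (1 + t)
         + t powr (x + 1) * (real m * r ^ (m - 1) * (- 2 / (1 + t)\<^sup>2)) / (1 + t)
         - t powr (x + 1) * r ^ m / (1 + t)\<^sup>2) = f t"
    proof -
      define P where "P = t powr x"
      have P1: "t powr (x + 1) = P * t"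
        using t1 by (simp add: powr_add P_def)
      have 1: "2 * (t / (1 + t)) = 1 - r" and 2: "4 * (t / (1 + t)\<^sup>2) = 1 - r\<^sup>2"
        using t1 by (simp_all add: r_def divide_simps power2_eq_square) (simp_all add: algebra_simps)
      have "2 * ((x + 1) * P * r ^ m / (1 + t)
         + P * t * (real m * r ^ (m - 1) * (- 2 / (1 + t)\<^sup>2)) / (1 + t)
         - P * t * r ^ m / (1 + t)\<^sup>2)
         = P / (1 + t) * (2 * (x + 1) * r ^ m - real m * r ^ (m - 1) * (4 * (t / (1 + t)\<^sup>2))
              - r ^ m * (2 * (t / (1 + t))))"
        using t1 by (simp add: power2_eq_square divide_simps) (simp add: algebra_simps)
      also have "\<dots> = P / (1 + t) * ((2 * x + 1) * r ^ m + real (m + 1) * r ^ Suc m - real m * r ^ (m - 1))"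
        unfolding 1 2 by (cases m) (simp_all add: algebra_simps power2_eq_square)
      also have "\<dots> = f t"
        using t1 unfolding f_def J_kernel_def r_def[symmetric] P_def by (simp add: algebra_simps add_divide_distrib diff_divide_distrib)
      finally show ?thesis unfolding P1 unfolding P_def .
    qed
    ultimately show "(H has_vector_derivative f t) (at t)"
      by (simp add: has_real_derivative_iff_has_vector_derivative)
  qed simp
  moreover have "(f has_integral ((2 * x + 1) * J m x + real (m + 1) * J (Suc m) x
                         - real m * J (m - 1) x)) {0..1}"
    unfolding f_def J_def
    by (intro has_integral_diff has_integral_add has_integral_mult_right
          integrable_integral J_kernel_integrable x)
  moreover have "H 1 - H 0 = (if m = 0 then 1 else 0)"
    by (simp add: H_def)
  ultimately show ?thesis
    by (metis has_integral_unique)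
qed

lemma J_Suc_0:
  assumes "x > 0"
  shows "J (Suc 0) x = 1 - (2 * x + 1) * J 0 x"
  using J_rec[OF assms, of 0] by simp

lemma J_Suc_Suc:
  assumes "x > 0"
  shows "(real m + 2) * J (Suc (Suc m)) x = (real m + 1) * J m x - (2 * x + 1) * J (Suc m) x"
  using J_rec[OF assms, of "Suc m"] by (simp add: algebra_simps)

text \<open>Drop the positive term \<open>J 0 (x + 1)\<close> from \<open>J_0_shift\<close>;
  monotonicity in \<open>m\<close> then makes the bound uniform in \<open>m\<close>.\<close>

lemma J_le:
  assumes "x > 0"
  shows "J m x \<le> 1 / (x + 1)"
proof (induction m)
  case 0
  show ?case
    using J_0_shift[OF assms] J_pos[of "x + 1" 0] assms by linarith
next
  case (Suc m)
  then show ?case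
    using J_decreasing[OF assms, of m] by linarith
qed

text \<open>The recurrence at \<open>x + 1\<close> expresses each \<open>J\<close> by the two before
  it, and the induction hypothesis moves those back to \<open>x\<close>. The step thus needs two
  earlier instances, so \<open>m = 0\<close> and \<open>m = 1\<close> are treated directly, starting
  from \<open>J_0_shift\<close>.\<close>

lemma J_shift:
  assumes x: "x > 0"
  shows "(x + 1) * J (Suc m) (x + 1) = (real m + 1) * J m x - (real m + x + 2) * J (Suc m) x"
proof (induction m rule: nat_less_induct)
  case (1 m)
  have x1: "x + 1 > 0"
    using x by simp
  have base: "(x + 1) * J 0 (x + 1) = 1 - (x + 1) * J 0 x"
    using J_0_shift[OF x] x by (simp add: field_simps)
  have step0: "(x + 1) * J (Suc 0) (x + 1) = J 0 x - (x + 2) * J (Suc 0) x"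
  proof -
    have "(x + 1) * J (Suc 0) (x + 1) = (x + 1) - (2 * x + 3) * ((x + 1) * J 0 (x + 1))"
      unfolding J_Suc_0[OF x1] by (simp add: algebra_simps)
    then show ?thesis
      unfolding base J_Suc_0[OF x] by (simp add: algebra_simps)
  qed
  consider "m = 0" | "m = 1" | k where "m = Suc (Suc k)"
    by (metis One_nat_def not0_implies_Suc)
  then show ?case
  proof cases
    case 1
    then show ?thesis using step0 by simp
  next
    case 2
    have "2 * J 2 (x + 1) = J 0 (x + 1) - (2 * x + 3) * J (Suc 0) (x + 1)"
      using J_Suc_Suc[OF x1, of 0] by (simp add: algebra_simps numeral_2_eq_2)
    then have "2 * ((x + 1) * J 2 (x + 1))
        = (x + 1) * J 0 (x + 1) - (2 * x + 3) * ((x + 1) * J (Suc 0) (x + 1))"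
      by algebra
    moreover have "2 * J 2 x = J 0 x - (2 * x + 1) * J (Suc 0) x"
      using J_Suc_Suc[OF x, of 0] by (simp add: algebra_simps numeral_2_eq_2)
    ultimately show ?thesis
      using J_Suc_0[OF x] unfolding base step0 2 One_nat_def numeral_2_eq_2[symmetric]
      by simp algebra
  next
    case 3
    define N where "N = real k"
    have N: "N + 2 > 0" "N + 3 > 0"
      by (simp_all add: N_def)
    have r0: "(N + 2) * J (Suc (Suc k)) x = (N + 1) * J k x - (2 * x + 1) * J (Suc k) x"
      using J_Suc_Suc[OF x, of k] by (simp add: N_def)
    have r1: "(N + 3) * J (Suc (Suc (Suc k))) x
        = (N + 2) * J (Suc k) x - (2 * x + 1) * J (Suc (Suc k)) x"
      using J_Suc_Suc[OF x, of "Suc k"] by (simp add: N_def algebra_simps)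
    have r2: "(N + 3) * J (Suc (Suc (Suc k))) (x + 1)
        = (N + 2) * J (Suc k) (x + 1) - (2 * x + 3) * J (Suc (Suc k)) (x + 1)"
      using J_Suc_Suc[OF x1, of "Suc k"] by (simp add: N_def algebra_simps)
    have i1: "(x + 1) * J (Suc k) (x + 1) = (N + 1) * J k x - (N + x + 2) * J (Suc k) x"
      using 1[rule_format, of k] 3 by (simp add: N_def)
    have i2: "(x + 1) * J (Suc (Suc k)) (x + 1)
        = (N + 2) * J (Suc k) x - (N + x + 3) * J (Suc (Suc k)) x"
      using 1[rule_format, of "Suc k"] 3 by (simp add: N_def algebra_simps)
    have "(N + 3) * ((x + 1) * J (Suc (Suc (Suc k))) (x + 1))
      = (N + 3) * ((N + 3) * J (Suc (Suc k)) x - (N + x + 4) * J (Suc (Suc (Suc k))) x)"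
      using r0 r1 r2 i1 i2 by algebra
    then have "(x + 1) * J (Suc (Suc (Suc k))) (x + 1)
      = (N + 3) * J (Suc (Suc k)) x - (N + x + 4) * J (Suc (Suc (Suc k))) x"
      using N by simp
    then show ?thesis
      unfolding 3 by (simp add: N_def algebra_simps)
  qed
qed

text \<open>Inserting \<open>J_shift\<close> at \<open>m\<close> and at \<open>Suc m\<close> into
  the right-hand side and reducing by the recurrence leaves \<open>J (Suc m) x\<close> with
  coefficient \<open>(m + 2)^2 + (m + x + 3) * (x - 1 - m) = (x + 1)^2\<close>, once everything is
  multiplied by \<open>x + 1\<close>. In this direction all coefficients are positive.\<close>

lemma J_shift_inverse:
  assumes x: "x > 0"
  shows "(x + 1) * J (Suc m) x
           = (real m + 2) * J (Suc (Suc m)) (x + 1) + (real m + x + 3) * J (Suc m) (x + 1)"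
proof -
  define N where "N = real m"
  have r: "(N + 2) * J (Suc (Suc m)) x = (N + 1) * J m x - (2 * x + 1) * J (Suc m) x"
    using J_Suc_Suc[OF x, of m] by (simp add: N_def)
  have b: "(x + 1) * J (Suc m) (x + 1) = (N + 1) * J m x - (N + x + 2) * J (Suc m) x"
    using J_shift[OF x, of m] by (simp add: N_def)
  have c: "(x + 1) * J (Suc (Suc m)) (x + 1)
      = (N + 2) * J (Suc m) x - (N + x + 3) * J (Suc (Suc m)) x"
    using J_shift[OF x, of "Suc m"] by (simp add: N_def algebra_simps)
  have "(x + 1) * ((x + 1) * J (Suc m) x)
    = (x + 1) * ((N + 2) * J (Suc (Suc m)) (x + 1) + (N + x + 3) * J (Suc m) (x + 1))"
    using r b c by algebra
  then show ?thesis
    using x by (simp add: N_def)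
qed

section \<open>The denominators \<open>Q m x\<close>\<close>

text \<open>The generating function in \<open>z\<close> is
  \<open>(1 + z)^x / (1 - z)^(x + 1)\<close>; at a natural number \<open>x = n\<close>,
  \<open>Q m n\<close> is the Delannoy number of \<open>(m, n)\<close>.\<close>

fun Q :: "nat \<Rightarrow> real \<Rightarrow> real" where
  "Q 0 x = 1"
| "Q (Suc 0) x = 2 * x + 1"
| "Q (Suc (Suc m)) x = ((2 * x + 1) * Q (Suc m) x + (real m + 1) * Q m x) / (real m + 2)"

declare Q.simps(3) [simp del]

lemma Q_Suc_Suc:
  "(real m + 2) * Q (Suc (Suc m)) x = (2 * x + 1) * Q (Suc m) x + (real m + 1) * Q m x"
  by (simp add: Q.simps(3) add_nonneg_eq_0_iff)

lemma Q_ge_1: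
  assumes "x \<ge> 0"
  shows "Q m x \<ge> 1"
  using assms
proof (induction m x rule: Q.induct)
  case (3 m x)
  have "real m + 2 \<le> (2 * x + 1) * 1 + (real m + 1) * 1"
    using 3 by simp
  also have "\<dots> \<le> (2 * x + 1) * Q (Suc m) x + (real m + 1) * Q m x"
    using 3 by (intro add_mono mult_left_mono) auto
  finally show ?case
    by (simp add: Q.simps(3))
qed auto

text \<open>The induction of \<open>J_shift\<close> with changed signs; here the two initial cases
  are polynomial identities.\<close>

lemma Q_shift:
  assumes x: "x > 0"
  shows "(x + 1) * Q (Suc m) (x + 1) = (real m + 1) * Q m x + (real m + x + 2) * Q (Suc m) x"
proof (induction m rule: nat_less_induct)
  case (1 m)
  consider "m = 0" | "m = 1" | k where "m = Suc (Suc k)"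
    by (metis One_nat_def not0_implies_Suc)
  then show ?case
  proof cases
    case 1
    then show ?thesis by (simp add: algebra_simps)
  next
    case 2
    then show ?thesis by (simp add: Q.simps(3) field_simps)
  next
    case 3
    define N where "N = real k"
    have N: "N + 2 > 0" "N + 3 > 0"
      by (simp_all add: N_def)
    have r0: "(N + 2) * Q (Suc (Suc k)) x = (N + 1) * Q k x + (2 * x + 1) * Q (Suc k) x"
      using Q_Suc_Suc[of k x] by (simp add: N_def)
    have r1: "(N + 3) * Q (Suc (Suc (Suc k))) x
        = (N + 2) * Q (Suc k) x + (2 * x + 1) * Q (Suc (Suc k)) x"
      using Q_Suc_Suc[of "Suc k" x] by (simp add: N_def algebra_simps)
    have r2: "(N + 3) * Q (Suc (Suc (Suc k))) (x + 1)
        = (N + 2) * Q (Suc k) (x + 1) + (2 * x + 3) * Q (Suc (Suc k)) (x + 1)"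
      using Q_Suc_Suc[of "Suc k" "x + 1"] by (simp add: N_def algebra_simps)
    have i1: "(x + 1) * Q (Suc k) (x + 1) = (N + 1) * Q k x + (N + x + 2) * Q (Suc k) x"
      using 1[rule_format, of k] 3 by (simp add: N_def)
    have i2: "(x + 1) * Q (Suc (Suc k)) (x + 1)
        = (N + 2) * Q (Suc k) x + (N + x + 3) * Q (Suc (Suc k)) x"
      using 1[rule_format, of "Suc k"] 3 by (simp add: N_def algebra_simps)
    have "(N + 3) * ((x + 1) * Q (Suc (Suc (Suc k))) (x + 1))
      = (N + 3) * ((N + 3) * Q (Suc (Suc k)) x + (N + x + 4) * Q (Suc (Suc (Suc k))) x)"
      using r0 r1 r2 i1 i2 by algebra
    then have "(x + 1) * Q (Suc (Suc (Suc k))) (x + 1)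
      = (N + 3) * Q (Suc (Suc k)) x + (N + x + 4) * Q (Suc (Suc (Suc k))) x"
      using N by simp
    then show ?thesis
      unfolding 3 by (simp add: N_def algebra_simps)
  qed
qed

section \<open>The tail of the series, the continued fraction and the exact error\<close>

text \<open>The left-hand side \<open>c n\<close> does not depend on \<open>n\<close>: by
  \<open>J_0_shift\<close> the new term of the partial sum is exactly the change of the correction.
  Since the correction tends to 0, the constant is the sum of the series.\<close>

lemma S_series_tail:
  assumes "p > 0" and "q > 0"
  shows "S_partial p q n + (-1) ^ (n + 1) * (J 0 (real n + real q / real p) / real p) = S_series p q"
proof -
  define s where "s = real q / real p"
  have s: "s > 0"
    using assms by (simp add: s_def)
  define c where "c n = S_partial p q n + (-1) ^ (n + 1) * (J 0 (real n + s) / real p)" for n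
  have "c (Suc n) = c n" for n
  proof -
    have x: "real n + s > 0"
      using s by (simp add: add_nonneg_pos)
    have "real p * s = real q"
      using assms by (simp add: s_def)
    then have "real (p * Suc n + q) = real p + real p * real n + real p * s"
      by (simp only: mult_Suc_right of_nat_add of_nat_mult)
    also have "\<dots> = real p * (real n + s + 1)"
      by (simp only: distrib_left mult_1_right add_ac)
    finally have "real (p * Suc n + q) = real p * (real n + s + 1)" .
    then have "1 / real (p * Suc n + q) = (J 0 (real n + s) + J 0 (real n + s + 1)) / real p"
      using J_0_shift[OF x] by simp
    moreover have "real (Suc n) + s = real n + s + 1"
      by simp
    moreover have "S_partial p q (Suc n) = S_partial p q n + (-1) ^ Suc n * (1 / real (p * Suc n + q))"
      by (simp only: S_partial_def sum.atLeast0_atMost_Suc times_divide_eq_right mult_1_right)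
    ultimately show ?thesis
      unfolding c_def by (simp add: algebra_simps add_divide_distrib)
  qed
  then have c_const: "c n = c 0" for n
    by (induction n) auto
  have "(\<lambda>n. S_partial p q n) \<longlonglongrightarrow> S_series p q"
    using summable_LIMSEQ'[OF S_series_summable[OF assms]]
    unfolding S_partial_def S_series_def atLeast0AtMost .
  moreover have "(\<lambda>n. (-1) ^ (n + 1) * (J 0 (real n + s) / real p)) \<longlonglongrightarrow> 0"
  proof (rule Lim_null_comparison)
    show "\<forall>\<^sub>F n in sequentially. norm ((-1) ^ (n + 1) * (J 0 (real n + s) / real p)) \<le> 1 / real (Suc n)"
    proof (intro always_eventually allI)
      fix n
      have x: "real n + s > 0"
        using s by (simp add: add_nonneg_pos)
      have "J 0 (real n + s) / real p \<le> J 0 (real n + s) / 1"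
        using assms J_pos[OF x, of 0] by (intro divide_left_mono) auto
      also have "\<dots> \<le> 1 / (real n + s + 1)"
        using J_le[OF x] by simp
      also have "\<dots> \<le> 1 / real (Suc n)"
        using s by (intro divide_left_mono) auto
      finally show "norm ((-1) ^ (n + 1) * (J 0 (real n + s) / real p)) \<le> 1 / real (Suc n)"
        using J_pos[OF x, of 0] by (simp add: abs_mult power_abs)
    qed
    show "(\<lambda>n. 1 / real (Suc n)) \<longlonglongrightarrow> 0"
      using LIMSEQ_inverse_real_of_nat by (simp add: inverse_eq_divide)
  qed
  ultimately have "c \<longlonglongrightarrow> S_series p q + 0"
    unfolding c_def by (rule tendsto_add)
  moreover have "c = (\<lambda>_. c 0)"
    by (rule ext) (rule c_const)
  ultimately have "(\<lambda>_. c 0) \<longlonglongrightarrow> S_series p q"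
    by simp
  then have "c 0 = S_series p q"
    by (simp add: LIMSEQ_const_iff)
  then show ?thesis
    using c_const[of n] by (simp add: c_def s_def)
qed


lemma cf_denom_pos:
  assumes "a > 0"
  shows "cf_denom p a i r > 0"
  using assms by (induction r arbitrary: i) (simp_all add: add_pos_nonneg less_imp_le)

text \<open>
  \<open>P\<close> is the product of the inner denominators; it does not depend on the solution \<open>f\<close>, so it cancels
  between two solutions.
\<close>

lemma cf_denom_eliminate_tail:
  assumes a: "a > 0"
  shows "\<exists>P>0. \<forall>f. (\<forall>m. f (Suc (Suc m)) = a * f (Suc m) + (real (Suc m * p))\<^sup>2 * f m) \<longrightarrow>
           f (Suc (Suc (i + r)))
             = P * (cf_denom p a (Suc i) r * f (Suc i) + (real (Suc i * p))\<^sup>2 * f i)"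
proof (induction r arbitrary: i)
  case 0
  show ?case
    by (rule exI[of _ 1]) simp
next
  case (Suc r)
  define C where "C = cf_denom p a (Suc (Suc i)) r"
  have C: "C > 0"
    unfolding C_def using a by (rule cf_denom_pos)
  obtain P where P: "P > 0" and
    rec: "\<And>f. (\<forall>m. f (Suc (Suc m)) = a * f (Suc m) + (real (Suc m * p))\<^sup>2 * f m) \<Longrightarrow>
      f (Suc (Suc (Suc i + r)))
        = P * (C * f (Suc (Suc i)) + (real (Suc (Suc i) * p))\<^sup>2 * f (Suc i))"
    using Suc[of "Suc i"] unfolding C_def by blast
  show ?case
  proof (intro exI[of _ "P * C"] conjI allI impI)
    show "P * C > 0"
      using P C by simp
    fix f :: "nat \<Rightarrow> real"
    assume f: "\<forall>m. f (Suc (Suc m)) = a * f (Suc m) + (real (Suc m * p))\<^sup>2 * f m"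
    define B where "B = (real (Suc (Suc i) * p))\<^sup>2"
    have "f (Suc (Suc (i + Suc r))) = P * (C * f (Suc (Suc i)) + B * f (Suc i))"
      using rec[OF f] by (simp add: B_def)
    also have "\<dots> = P * C * ((a + B / C) * f (Suc i) + (real (Suc i * p))\<^sup>2 * f i)"
      using C f[rule_format, of i] by (simp add: field_simps)
    also have "a + B / C = cf_denom p a (Suc i) (Suc r)"
      by (simp add: B_def C_def)
    finally show "f (Suc (Suc (i + Suc r)))
      = P * C * (cf_denom p a (Suc i) (Suc r) * f (Suc i) + (real (Suc i * p))\<^sup>2 * f i)" .
  qed
qed

text \<open>The difference \<open>f (Suc 0) - a * f 0\<close> plays the part of the missing term
  before \<open>f 0\<close>. It is 0 for the solution built from \<open>Q\<close> and
  \<open>- p\<close> for the one built from \<open>J\<close>, so the two solutions separate the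
  denominator of the fraction from its error.\<close>

lemma cf_denom_eliminate:
  assumes a: "a > 0"
  shows "\<exists>P>0. \<forall>f. (\<forall>m. f (Suc (Suc m)) = a * f (Suc m) + (real (Suc m * p))\<^sup>2 * f m) \<longrightarrow>
           f (Suc n) = P * (cf_denom p a 0 n * f 0 + (f (Suc 0) - a * f 0))"
proof (cases n)
  case 0
  show ?thesis
    unfolding 0 by (rule exI[of _ 1]) simp
next
  case (Suc r)
  define C where "C = cf_denom p a (Suc 0) r"
  have C: "C > 0"
    unfolding C_def using a by (rule cf_denom_pos)
  obtain P where P: "P > 0" and
    rec: "\<And>f. (\<forall>m. f (Suc (Suc m)) = a * f (Suc m) + (real (Suc m * p))\<^sup>2 * f m) \<Longrightarrow>
      f (Suc (Suc r)) = P * (C * f (Suc 0) + (real p)\<^sup>2 * f 0)"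
    using cf_denom_eliminate_tail[OF a, of p 0 r] unfolding C_def by force
  show ?thesis
  proof (intro exI[of _ "P * C"] conjI allI impI)
    show "P * C > 0"
      using P C by simp
    fix f :: "nat \<Rightarrow> real"
    assume f: "\<forall>m. f (Suc (Suc m)) = a * f (Suc m) + (real (Suc m * p))\<^sup>2 * f m"
    define D where "D = cf_denom p a 0 n"
    define R where "R = (real p)\<^sup>2"
    have "D = a + R / C"
      by (simp add: C_def D_def R_def Suc)
    then have "D * C = a * C + R"
      using C by (simp add: distrib_right)
    moreover have "f (Suc n) = P * (C * f (Suc 0) + R * f 0)"
      using rec[OF f] by (simp add: Suc R_def)
    ultimately have "f (Suc n) = P * C * (D * f 0 + (f (Suc 0) - a * f 0))"
      by algebra
    then show "f (Suc n) = P * C * (cf_denom p a 0 n * f 0 + (f (Suc 0) - a * f 0))"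
      unfolding D_def .
  qed
qed

text \<open>Dividing the relation for \<open>J\<close> by the one for \<open>Q\<close> cancels
  \<open>P\<close> and \<open>K\<close> and leaves \<open>J 0 x / p - 1 / c\<close>, the exact tail
  minus its approximation by the continued fraction. The alternating sign of the \<open>J\<close>
  solution cancels that of the series, so the error is always negative.\<close>

lemma w_error:
  fixes p q n :: nat
  assumes p: "p > 0" and q: "q > 0"
  defines "x \<equiv> real n + real q / real p"
  shows "w p q n - S_series p q = - (J (Suc n) x / (real p * Q (Suc n) x))"
proof -
  define a where "a = alpha p q n"
  define c where "c = cf_denom p a 0 n"
  define K where "K = fact (Suc n) * real p ^ Suc n"
  have x: "x > 0"
    using p q by (simp add: x_def add_nonneg_pos)
  have a_eq: "a = real p * (2 * x + 1)"
    using p by (simp add: a_def alpha_def x_def distrib_left)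
  then have a: "a > 0"
    using x p by simp
  have c: "c > 0"
    unfolding c_def using a by (rule cf_denom_pos)
  have K: "K > 0"
    using p by (simp add: K_def)
  have Q: "Q (Suc n) x > 0"
    using Q_ge_1[of x "Suc n"] x by linarith
  obtain P where P: "P > 0" and
    rec: "\<And>f. (\<forall>m. f (Suc (Suc m)) = a * f (Suc m) + (real (Suc m * p))\<^sup>2 * f m) \<Longrightarrow>
      f (Suc n) = P * (c * f 0 + (f (Suc 0) - a * f 0))"
    using cf_denom_eliminate[OF a, of p n] unfolding c_def by blast
  have "K * Q (Suc n) x = P * c"
  proof -
    define f where "f m = fact m * real p ^ m * Q m x" for m
    have "f (Suc (Suc m)) = a * f (Suc m) + (real (Suc m * p))\<^sup>2 * f m" for m
    proof -
      have "f (Suc (Suc m)) = fact (Suc m) * real p ^ Suc (Suc m) * ((real m + 2) * Q (Suc (Suc m)) x)"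
        by (simp add: f_def algebra_simps)
      also have "\<dots> = a * f (Suc m) + (real (Suc m * p))\<^sup>2 * f m"
        unfolding Q_Suc_Suc f_def a_eq by (simp add: algebra_simps power2_eq_square)
      finally show ?thesis .
    qed
    from rec[of f, OF allI[OF this]] show ?thesis
      by (simp add: f_def K_def a_eq)
  qed
  moreover have "(-1) ^ Suc n * K * J (Suc n) x = P * (c * J 0 x - real p)"
  proof -
    define f where "f m = (-1) ^ m * fact m * real p ^ m * J m x" for m
    have "f (Suc (Suc m)) = a * f (Suc m) + (real (Suc m * p))\<^sup>2 * f m" for m
    proof -
      have "f (Suc (Suc m)) = (-1) ^ m * fact (Suc m) * real p ^ Suc (Suc m) * ((real m + 2) * J (Suc (Suc m)) x)"
        by (simp add: f_def algebra_simps)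
      also have "\<dots> = a * f (Suc m) + (real (Suc m * p))\<^sup>2 * f m"
        unfolding J_Suc_Suc[OF x] f_def a_eq by (simp add: algebra_simps power2_eq_square)
      finally show ?thesis .
    qed
    from rec[of f, OF allI[OF this]] show ?thesis
      by (simp add: f_def K_def a_eq J_Suc_0[OF x]) (simp add: algebra_simps)
  qed
  ultimately have "(P * (c * J 0 x - real p)) / (real p * (P * c))
      = ((-1) ^ Suc n * K * J (Suc n) x) / (real p * (K * Q (Suc n) x))"
    by simp
  also have "(P * (c * J 0 x - real p)) / (real p * (P * c)) = J 0 x / real p - 1 / c"
    using P c p by (simp add: field_simps)
  also have "((-1) ^ Suc n * K * J (Suc n) x) / (real p * (K * Q (Suc n) x))
      = (-1) ^ Suc n * (J (Suc n) x / (real p * Q (Suc n) x))"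
    using K by simp
  finally have "J 0 x / real p - 1 / c = (-1) ^ Suc n * (J (Suc n) x / (real p * Q (Suc n) x))" .
  moreover have "w p q n - S_series p q = - ((-1) ^ Suc n * (J 0 x / real p - 1 / c))"
    using S_series_tail[OF p q, of n]
    by (simp add: w_def rho_def x_def c_def a_def algebra_simps)
  moreover have "(-1) ^ Suc n * ((-1) ^ Suc n * t) = t" for t :: real
    by (metis left_minus_one_mult_self)
  ultimately show ?thesis
    by simp
qed

section \<open>Perturbed contractions and Moebius maps with convergent coefficients\<close>

text \<open>\<open>e\<close> is the fixed point of the affine map
  \<open>t \<mapsto> (1 - \<kappa>) * e + \<kappa> * t\<close>, so each step multiplies the bound on
  the excess over \<open>e\<close> by \<open>\<kappa>\<close>.\<close>

lemma iterate_contraction_bound: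
  fixes a :: "nat \<Rightarrow> real"
  assumes "0 \<le> \<kappa>" "\<And>k. a (Suc k) \<le> (1 - \<kappa>) * e + \<kappa> * a k"
  shows "a k \<le> e + \<kappa> ^ k * (a 0 - e)"
proof (induction k)
  case (Suc k)
  have "a (Suc k) \<le> (1 - \<kappa>) * e + \<kappa> * (e + \<kappa> ^ k * (a 0 - e))"
    using assms(2)[of k] mult_left_mono[OF Suc assms(1)] by linarith
  then show ?case
    by (simp add: algebra_simps)
qed simp

lemma forward_contraction_tendsto_0:
  fixes a \<epsilon> :: "nat \<Rightarrow> real"
  assumes a: "\<And>n. a n \<ge> 0" and \<kappa>: "0 \<le> \<kappa>" "\<kappa> < 1" and \<epsilon>: "\<epsilon> \<longlonglongrightarrow> 0"
    and le: "\<forall>\<^sub>F n in sequentially. a (Suc n) \<le> \<epsilon> n + \<kappa> * a n"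
  shows "a \<longlonglongrightarrow> 0"
proof (rule tendstoI)
  fix e :: real assume e: "e > 0"
  have "\<forall>\<^sub>F n in sequentially. \<epsilon> n < (1 - \<kappa>) * (e / 2)"
    using \<epsilon> by (rule order_tendstoD) (use \<kappa> e in simp)
  with le have "\<forall>\<^sub>F n in sequentially. a (Suc n) \<le> (1 - \<kappa>) * (e / 2) + \<kappa> * a n"
    by eventually_elim linarith
  then obtain N where N: "\<And>n. n \<ge> N \<Longrightarrow> a (Suc n) \<le> (1 - \<kappa>) * (e / 2) + \<kappa> * a n"
    by (auto simp: eventually_sequentially)
  have bound: "a (N + k) \<le> e / 2 + \<kappa> ^ k * (a N - e / 2)" for k
    using iterate_contraction_bound[of \<kappa> "\<lambda>k. a (N + k)" "e / 2" k] \<kappa> N by simp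
  have "(\<lambda>k. e / 2 + \<kappa> ^ k * (a N - e / 2)) \<longlonglongrightarrow> e / 2 + 0 * (a N - e / 2)"
    by (intro tendsto_intros LIMSEQ_power_zero) (use \<kappa> in simp)
  then have "\<forall>\<^sub>F k in sequentially. e / 2 + \<kappa> ^ k * (a N - e / 2) < e"
    by (rule order_tendstoD) (use e in simp)
  then have "\<forall>\<^sub>F k in sequentially. dist (a (k + N)) 0 < e"
  proof eventually_elim
    case (elim k)
    then show ?case
      using bound[of k] a[of "k + N"] by (simp add: add.commute)
  qed
  then show "\<forall>\<^sub>F n in sequentially. dist (a n) 0 < e"
    by (rule eventually_sequentially_seg[THEN iffD1])
qed

text \<open>Each term is controlled by later ones, so there is no initial value to start from. The
  uniform bound \<open>M\<close> replaces it: one \<open>k\<close> with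
  \<open>e + \<kappa> ^ k * M < e'\<close> serves every \<open>n \<ge> N\<close>.\<close>

lemma backward_contraction_tendsto_0:
  fixes a \<epsilon> :: "nat \<Rightarrow> real"
  assumes a: "\<And>n. a n \<ge> 0" "\<And>n. a n \<le> M"
    and \<kappa>: "0 \<le> \<kappa>" "\<kappa> < 1" and \<epsilon>: "\<epsilon> \<longlonglongrightarrow> 0"
    and le: "\<forall>\<^sub>F n in sequentially. a n \<le> \<epsilon> n + \<kappa> * a (Suc n)"
  shows "a \<longlonglongrightarrow> 0"
proof (rule tendstoI)
  fix e' :: real assume "e' > 0"
  define e where "e = e' / 2"
  have e: "e > 0" "e' = 2 * e"
    using \<open>e' > 0\<close> by (simp_all add: e_def)
  have "\<forall>\<^sub>F n in sequentially. \<epsilon> n < (1 - \<kappa>) * e"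
    using \<epsilon> by (rule order_tendstoD) (use \<kappa> e in simp)
  with le have "\<forall>\<^sub>F n in sequentially. a n \<le> (1 - \<kappa>) * e + \<kappa> * a (Suc n)"
    by eventually_elim linarith
  then obtain N where N: "\<And>n. n \<ge> N \<Longrightarrow> a n \<le> (1 - \<kappa>) * e + \<kappa> * a (Suc n)"
    by (auto simp: eventually_sequentially)
  have bound: "a n \<le> e + \<kappa> ^ k * (a (n + k) - e)" if "n \<ge> N" for n k
    using that
  proof (induction k arbitrary: n)
    case (Suc k)
    have "a n \<le> (1 - \<kappa>) * e + \<kappa> * (e + \<kappa> ^ k * (a (Suc n + k) - e))"
      using N[OF Suc.prems] mult_left_mono[OF Suc.IH[of "Suc n"] \<kappa>(1)] Suc.prems by linarith
    then show ?case
      by (simp add: algebra_simps)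
  qed simp
  have "(\<lambda>k. e + \<kappa> ^ k * M) \<longlonglongrightarrow> e + 0 * M"
    by (intro tendsto_intros LIMSEQ_power_zero) (use \<kappa> in simp)
  then have "\<forall>\<^sub>F k in sequentially. e + \<kappa> ^ k * M < e'"
    by (rule order_tendstoD) (use e in simp)
  then obtain k where k: "e + \<kappa> ^ k * M < e'"
    by (auto simp: eventually_sequentially)
  have "dist (a n) 0 < e'" if "n \<ge> N" for n
  proof -
    have "a n \<le> e + \<kappa> ^ k * (a (n + k) - e)"
      using that by (rule bound)
    also have "\<dots> \<le> e + \<kappa> ^ k * M"
      using a(2)[of "n + k"] e \<kappa>(1) by (intro add_left_mono mult_left_mono) auto
    finally show ?thesis
      using k a(1)[of n] by simp
  qed
  then show "\<forall>\<^sub>F n in sequentially. dist (a n) 0 < e'"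
    by (auto simp: eventually_sequentially)
qed

text \<open>Subtracting \<open>L\<close> from \<open>g' = (a + b * g) / (e + f * g)\<close> gives
  \<open>(g' - L) * (e + f * g) = r + (b - L * f) * (g - L)\<close>, where \<open>r\<close> tends to
  0 by the fixed point equation. Since \<open>f * g \<ge> 0\<close>, the denominator is at least
  \<open>e\<close>, and the factor \<open>\<bar>b - L * f\<bar> / e\<close> has a limit below 1.
  Keeping \<open>g\<close> and \<open>g'\<close> separate lets the lemma serve both directions of
  iteration.\<close>

lemma moebius_contraction:
  fixes a b e f g g' :: "nat \<Rightarrow> real"
  assumes lim: "a \<longlonglongrightarrow> \<alpha>" "b \<longlonglongrightarrow> \<beta>" "e \<longlonglongrightarrow> \<eta>" "f \<longlonglongrightarrow> \<phi>"
    and fixpoint: "L * (\<eta> + \<phi> * L) = \<alpha> + \<beta> * L"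
    and contr: "\<bar>\<beta> - L * \<phi>\<bar> < \<eta>"
    and nonneg: "\<And>n. f n \<ge> 0" "\<And>n. g n \<ge> 0"
    and step: "\<And>n. g' n * (e n + f n * g n) = a n + b n * g n"
  shows "\<exists>\<epsilon> \<kappa>. \<epsilon> \<longlonglongrightarrow> 0 \<and> 0 \<le> \<kappa> \<and> \<kappa> < 1 \<and>
    (\<forall>\<^sub>F n in sequentially. \<bar>g' n - L\<bar> \<le> \<epsilon> n + \<kappa> * \<bar>g n - L\<bar>)"
proof -
  define r where "r n = a n - L * e n + (b n - L * f n) * L" for n
  have \<eta>: "\<eta> > 0"
    using contr by linarith
  have "r \<longlonglongrightarrow> \<alpha> - L * \<eta> + (\<beta> - L * \<phi>) * L"
    unfolding r_def by (intro tendsto_intros lim)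
  also have "\<alpha> - L * \<eta> + (\<beta> - L * \<phi>) * L = 0"
    using fixpoint by algebra
  finally have "(\<lambda>n. \<bar>r n\<bar> / e n) \<longlonglongrightarrow> \<bar>0\<bar> / \<eta>"
    using \<eta> by (intro tendsto_intros lim) auto
  then have 1: "(\<lambda>n. \<bar>r n\<bar> / e n) \<longlonglongrightarrow> 0"
    by simp
  have "\<bar>\<beta> - L * \<phi>\<bar> / \<eta> < 1"
    using contr \<eta> by simp
  then obtain \<kappa> where \<kappa>: "\<bar>\<beta> - L * \<phi>\<bar> / \<eta> < \<kappa>" "\<kappa> < 1"
    using dense by blast
  have \<kappa>0: "0 \<le> \<kappa>"
    using divide_nonneg_pos[OF abs_ge_zero \<eta>, of "\<beta> - L * \<phi>"] \<kappa>(1) by linarith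
  have "(\<lambda>n. \<bar>b n - L * f n\<bar> / e n) \<longlonglongrightarrow> \<bar>\<beta> - L * \<phi>\<bar> / \<eta>"
    using \<eta> by (intro tendsto_intros lim) auto
  then have "\<forall>\<^sub>F n in sequentially. \<bar>b n - L * f n\<bar> / e n < \<kappa>"
    using \<kappa>(1) by (rule order_tendstoD)
  moreover have "\<forall>\<^sub>F n in sequentially. e n > 0"
    using lim(3) \<eta> by (rule order_tendstoD)
  ultimately have 2: "\<forall>\<^sub>F n in sequentially. \<bar>g' n - L\<bar> \<le> \<bar>r n\<bar> / e n + \<kappa> * \<bar>g n - L\<bar>"
  proof eventually_elim
    case (elim n)
    have "\<bar>g' n - L\<bar> * e n \<le> \<bar>g' n - L\<bar> * (e n + f n * g n)"
      using nonneg[of n] by (intro mult_left_mono) auto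
    also have "\<dots> = \<bar>(g' n - L) * (e n + f n * g n)\<bar>"
      using elim nonneg[of n] by (simp add: abs_mult)
    also have "(g' n - L) * (e n + f n * g n) = r n + (b n - L * f n) * (g n - L)"
      using step[of n] unfolding r_def by algebra
    also have "\<bar>\<dots>\<bar> \<le> \<bar>r n\<bar> + \<bar>b n - L * f n\<bar> * \<bar>g n - L\<bar>"
      by (metis abs_mult abs_triangle_ineq)
    finally have "\<bar>g' n - L\<bar> \<le> \<bar>r n\<bar> / e n + \<bar>b n - L * f n\<bar> / e n * \<bar>g n - L\<bar>"
      using elim by (simp add: field_simps)
    also have "\<dots> \<le> \<bar>r n\<bar> / e n + \<kappa> * \<bar>g n - L\<bar>"
      using elim by (intro add_left_mono mult_right_mono) auto
    finally show ?case .
  qed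
  show ?thesis
    by (intro exI conjI) (rule 1 \<kappa>0 \<kappa>(2) 2)+
qed


section \<open>Limits of quotients along the diagonal \<open>x = n + s\<close>\<close>

text \<open>Such precision is needed because \<open>17 - 12 * sqrt 2\<close> suffers cancellation;
  these bounds place it between 0.0284 and 0.032.\<close>

lemma sqrt_2_bounds: "707 / 500 < sqrt 2" "sqrt 2 < 14143 / 10000"
  by (rule real_less_rsqrt, simp add: power2_eq_square)
     (rule real_less_lsqrt, simp_all add: power2_eq_square)

text \<open>The limit map, from \<open>d (Suc n)\<close> to \<open>d n\<close>, is
  \<open>t \<mapsto> (2 + t) / (5 + 2 * t)\<close>, with attracting fixed point
  \<open>sqrt 2 - 1\<close>. Read forwards this point repels, which is why the orbit is followed
  backwards, with \<open>0 \<le> d n \<le> 1\<close> as the uniform bound.\<close>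

lemma J_diagonal_quotient_tendsto:
  fixes s :: real
  assumes s: "s > 0"
  shows "(\<lambda>n. J (Suc n) (real n + s) / J n (real n + s)) \<longlonglongrightarrow> sqrt 2 - 1"
proof -
  define d where "d n = J (Suc n) (real n + s) / J n (real n + s)" for n
  \<comment> \<open>Numerator and denominator of the Moebius map are both divided by
    \<open>(n + 1)^2\<close>, so that all four coefficients converge.\<close>
  define e where "e n = ((real n + s + 1)\<^sup>2 + (2 * real n + s + 2) * (2 * real n + s + 3))
    / (real n + 1)\<^sup>2" for n
  define f where "f n = (2 * real n + s + 2) * (real n + 2) / (real n + 1)\<^sup>2" for n
  define a where "a n = (2 * real n + s + 3) / (real n + 1)" for n
  define b where "b n = (real n + 2) / (real n + 1)" for n
  have step: "d n * (e n + f n * d (Suc n)) = a n + b n * d (Suc n)" for n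
  proof -
    define x where "x = real n + s"
    define N where "N = real n"
    define u v B C where "u = J n x" and "v = J (Suc n) x"
      and "B = J (Suc n) (x + 1)" and "C = J (Suc (Suc n)) (x + 1)"
    have x: "x > 0" "real (Suc n) + s = x + 1" "2 * real n + s = N + x"
      using s by (auto simp: x_def N_def add_nonneg_pos)
    have N: "N + 1 > 0"
      by (simp add: N_def)
    have pos: "u > 0" "B > 0"
      using x by (simp_all add: u_def B_def J_pos)
    have d: "d n = v / u" "d (Suc n) = C / B"
      unfolding d_def x(2) by (simp_all add: x_def u_def v_def B_def C_def)
    have 1: "(x + 1) * B = (N + 1) * u - (N + x + 2) * v"
      using J_shift[OF x(1), of n] by (simp add: u_def v_def B_def N_def)
    have 2: "(x + 1) * v = (N + 2) * C + (N + x + 3) * B"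
      using J_shift_inverse[OF x(1), of n] by (simp add: v_def B_def C_def N_def)
    define E F where "E = (x + 1)\<^sup>2 + (N + x + 2) * (N + x + 3)" and "F = (N + x + 2) * (N + 2)"
    have "e n = E / (N + 1)\<^sup>2" "f n = F / (N + 1)\<^sup>2"
      unfolding e_def f_def x(3)
      unfolding x_def[symmetric] unfolding N_def[symmetric] E_def F_def by simp_all
    then have "e n + f n * d (Suc n) = (E * B + F * C) / ((N + 1)\<^sup>2 * B)"
      unfolding d using N pos by (simp add: add_divide_distrib)
    \<comment> \<open>Solve \<open>J_shift\<close> for \<open>u\<close> and replace \<open>v\<close>
      by means of \<open>J_shift_inverse\<close>.\<close>
    also have "E * B + F * C = (N + 1) * ((x + 1) * u)"
      unfolding E_def F_def using 1 2 by algebra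
    also have "(N + 1) * ((x + 1) * u) / ((N + 1)\<^sup>2 * B) = (x + 1) * u / ((N + 1) * B)"
      using N by (simp add: power2_eq_square)
    finally have "d n * (e n + f n * d (Suc n)) = (x + 1) * v / ((N + 1) * B)"
      unfolding d using pos by simp
    moreover have *: "T / M + K / M * (C / B) = (K * C + T * B) / (M * B)" for K M T
      using pos by (simp add: add_divide_distrib)
    have "a n + b n * d (Suc n) = ((N + 2) * C + (N + x + 3) * B) / ((N + 1) * B)"
      unfolding d a_def b_def x(3) unfolding N_def[symmetric] by (rule *)
    ultimately show ?thesis
      unfolding 2 by simp
  qed
  have d_bounds: "0 \<le> d n" "d n \<le> 1" for n
  proof -
    have "real n + s > 0"
      using s by (simp add: add_nonneg_pos)
    from J_pos[OF this] J_decreasing[OF this, of n] show "0 \<le> d n" "d n \<le> 1"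
      by (simp_all add: d_def less_imp_le)
  qed
  have "\<exists>\<epsilon> \<kappa>. \<epsilon> \<longlonglongrightarrow> 0 \<and> 0 \<le> \<kappa> \<and> \<kappa> < 1 \<and>
    (\<forall>\<^sub>F n in sequentially. \<bar>d n - (sqrt 2 - 1)\<bar> \<le> \<epsilon> n + \<kappa> * \<bar>d (Suc n) - (sqrt 2 - 1)\<bar>)"
  proof (rule moebius_contraction[where g = "\<lambda>n. d (Suc n)" and g' = d])
    show "a \<longlonglongrightarrow> 2" "b \<longlonglongrightarrow> 1" "e \<longlonglongrightarrow> 5" "f \<longlonglongrightarrow> 2"
      unfolding a_def b_def e_def f_def by real_asymp+
    show "(sqrt 2 - 1) * (5 + 2 * (sqrt 2 - 1)) = 2 + 1 * (sqrt 2 - 1)"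
      by (simp add: algebra_simps)
    show "\<bar>1 - (sqrt 2 - 1) * 2\<bar> < 5"
      using sqrt_2_bounds by (simp add: abs_less_iff)
    show "0 \<le> f n" for n
      using s by (simp add: f_def)
  qed (rule d_bounds step)+
  then obtain \<epsilon> \<kappa> where \<epsilon>: "\<epsilon> \<longlonglongrightarrow> 0" and \<kappa>: "0 \<le> \<kappa>" "\<kappa> < 1" and
    le: "\<forall>\<^sub>F n in sequentially. \<bar>d n - (sqrt 2 - 1)\<bar> \<le> \<epsilon> n + \<kappa> * \<bar>d (Suc n) - (sqrt 2 - 1)\<bar>"
    by blast
  have "\<bar>d n - (sqrt 2 - 1)\<bar> \<le> 2" for n
    using d_bounds[of n] sqrt_2_bounds by linarith
  from backward_contraction_tendsto_0[OF abs_ge_zero this \<kappa> \<epsilon> le]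
  have "(\<lambda>n. \<bar>d n - (sqrt 2 - 1)\<bar>) \<longlonglongrightarrow> 0" .
  then show ?thesis
    unfolding d_def by (simp add: tendsto_rabs_zero_iff LIM_zero_iff)
qed

text \<open>\<open>Q_shift\<close> has positive coefficients, so here the iteration runs forwards.
  The limit map \<open>t \<mapsto> (2 + 5 * t) / (1 + 2 * t)\<close> has the attracting fixed point
  \<open>1 + sqrt 2\<close>.\<close>

lemma Q_diagonal_quotient_tendsto:
  fixes s :: real
  assumes s: "s > 0"
  shows "(\<lambda>n. Q (Suc n) (real n + s) / Q n (real n + s)) \<longlonglongrightarrow> 1 + sqrt 2"
proof -
  define h where "h n = Q (Suc n) (real n + s) / Q n (real n + s)" for n
  define e where "e n = (real n + 2) / (real n + 1)" for n
  define f where "f n = (real n + 2) * (2 * real n + s + 2) / (real n + 1)\<^sup>2" for n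
  define a where "a n = (2 * real n + s + 3) / (real n + 1)" for n
  define b where "b n = ((real n + 2)\<^sup>2 + (2 * real n + s + 3) * (2 * real n + 2 * s + 1))
    / (real n + 1)\<^sup>2" for n
  have step: "h (Suc n) * (e n + f n * h n) = a n + b n * h n" for n
  proof -
    define x where "x = real n + s"
    define N where "N = real n"
    define u v B C where "u = Q n x" and "v = Q (Suc n) x"
      and "B = Q (Suc n) (x + 1)" and "C = Q (Suc (Suc n)) (x + 1)"
    have x: "x > 0" "real (Suc n) + s = x + 1" "2 * real n + s = N + x" "2 * real n + 2 * s = 2 * x"
      using s by (auto simp: x_def N_def add_nonneg_pos)
    have N: "N + 1 > 0" "N + 2 > 0"
      by (simp_all add: N_def)
    have pos: "u > 0" "B > 0"
      using x Q_ge_1[of x n] Q_ge_1[of "x + 1" "Suc n"] by (auto simp: u_def B_def)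
    have h: "h n = v / u" "h (Suc n) = C / B"
      unfolding h_def x(2) by (simp_all add: x_def u_def v_def B_def C_def)
    have 1: "(x + 1) * B = (N + 1) * u + (N + x + 2) * v"
      using Q_shift[OF x(1), of n] by (simp add: u_def v_def B_def N_def)
    \<comment> \<open>The shift of \<open>C\<close> involves \<open>Q (Suc (Suc n)) x\<close>, which
      the recurrence in \<open>m\<close> removes at the cost of a factor
      \<open>N + 2\<close>.\<close>
    have "(x + 1) * C = (N + 2) * v + (N + x + 3) * Q (Suc (Suc n)) x"
      using Q_shift[OF x(1), of "Suc n"] by (simp add: v_def C_def N_def algebra_simps)
    moreover have "(N + 2) * Q (Suc (Suc n)) x = (2 * x + 1) * v + (N + 1) * u"
      using Q_Suc_Suc[of n x] by (simp add: u_def v_def N_def)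
    ultimately have 2: "(x + 1) * ((N + 2) * C)
        = ((N + 2)\<^sup>2 + (N + x + 3) * (2 * x + 1)) * v + (N + 1) * (N + x + 3) * u"
      by algebra
    have *: "K / M + T / M\<^sup>2 * (v / u) = (T * v + M * K * u) / (M\<^sup>2 * u)" if "M > 0" for K M T
      using that pos(1) by (simp add: field_simps power2_eq_square)
    have "e n + f n * h n = ((N + 2) * (N + x + 2) * v + (N + 1) * (N + 2) * u) / ((N + 1)\<^sup>2 * u)"
      unfolding h e_def f_def x(3,4)
      unfolding N_def[symmetric] using N(1) by (rule *)
    also have "(N + 2) * (N + x + 2) * v + (N + 1) * (N + 2) * u = (N + 2) * ((x + 1) * B)"
      using 1 by algebra
    finally have "e n + f n * h n = (N + 2) * ((x + 1) * B) / ((N + 1)\<^sup>2 * u)" .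
    moreover have "a n + b n * h n = ((x + 1) * ((N + 2) * C)) / ((N + 1)\<^sup>2 * u)"
      unfolding h a_def b_def x(3,4) 2
      unfolding N_def[symmetric] using N(1) by (rule *)
    ultimately show ?thesis
      unfolding h(2) using pos by simp
  qed
  have h_nonneg: "0 \<le> h n" for n
  proof -
    have "real n + s \<ge> 0"
      using s by simp
    from Q_ge_1[OF this, of n] Q_ge_1[OF this, of "Suc n"] show ?thesis
      by (simp add: h_def)
  qed
  have "\<exists>\<epsilon> \<kappa>. \<epsilon> \<longlonglongrightarrow> 0 \<and> 0 \<le> \<kappa> \<and> \<kappa> < 1 \<and>
    (\<forall>\<^sub>F n in sequentially. \<bar>h (Suc n) - (1 + sqrt 2)\<bar> \<le> \<epsilon> n + \<kappa> * \<bar>h n - (1 + sqrt 2)\<bar>)"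
  proof (rule moebius_contraction[where g = h and g' = "\<lambda>n. h (Suc n)"])
    show "a \<longlonglongrightarrow> 2" "b \<longlonglongrightarrow> 5" "e \<longlonglongrightarrow> 1" "f \<longlonglongrightarrow> 2"
      unfolding a_def b_def e_def f_def by real_asymp+
    show "(1 + sqrt 2) * (1 + 2 * (1 + sqrt 2)) = 2 + 5 * (1 + sqrt 2)"
      by (simp add: algebra_simps)
    show "\<bar>5 - (1 + sqrt 2) * 2\<bar> < 1"
      using sqrt_2_bounds by (simp add: abs_less_iff)
    show "0 \<le> f n" for n
      using s by (simp add: f_def)
  qed (rule h_nonneg step)+
  then obtain \<epsilon> \<kappa> where \<epsilon>: "\<epsilon> \<longlonglongrightarrow> 0" and \<kappa>: "0 \<le> \<kappa>" "\<kappa> < 1" and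
    le: "\<forall>\<^sub>F n in sequentially. \<bar>h (Suc n) - (1 + sqrt 2)\<bar> \<le> \<epsilon> n + \<kappa> * \<bar>h n - (1 + sqrt 2)\<bar>"
    by blast
  from forward_contraction_tendsto_0[OF abs_ge_zero \<kappa> \<epsilon> le]
  have "(\<lambda>n. \<bar>h n - (1 + sqrt 2)\<bar>) \<longlonglongrightarrow> 0" .
  then show ?thesis
    unfolding h_def by (simp add: tendsto_rabs_zero_iff LIM_zero_iff)
qed

text \<open>Write the ratio as \<open>(C / B) / (v / B)\<close>: \<open>C / B\<close> is
  \<open>d (Suc n)\<close>, and \<open>J_shift_inverse\<close> makes \<open>v / B\<close> an affine
  function of it.\<close>

lemma J_diagonal_ratio_tendsto:
  fixes s :: real
  assumes s: "s > 0"
  shows "(\<lambda>n. J (Suc (Suc n)) (real (Suc n) + s) / J (Suc n) (real n + s)) \<longlonglongrightarrow> 3 - 2 * sqrt 2"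
proof -
  define d where "d n = J (Suc n) (real n + s) / J n (real n + s)" for n
  have eq: "J (Suc (Suc n)) (real (Suc n) + s) / J (Suc n) (real n + s)
    = d (Suc n) / ((real n + 2) / (real n + s + 1) * d (Suc n) + (2 * real n + s + 3) / (real n + s + 1))"
    for n
  proof -
    define x where "x = real n + s"
    define v B C where "v = J (Suc n) x"
      and "B = J (Suc n) (x + 1)" and "C = J (Suc (Suc n)) (x + 1)"
    have x: "x > 0" "real (Suc n) + s = x + 1" "2 * real n + s = real n + x"
      using s by (auto simp: x_def add_nonneg_pos)
    have pos: "v > 0" "B > 0"
      using x by (simp_all add: v_def B_def J_pos)
    have d: "d (Suc n) = C / B"
      unfolding d_def x(2) by (simp add: B_def C_def)
    have *: "((a * C + b * B) / t) / B = a / t * (C / B) + b / t" for a b t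
      using pos(2) by (simp add: add_divide_distrib)
    have v: "v = ((real n + 2) * C + (real n + x + 3) * B) / (x + 1)"
      using J_shift_inverse[OF x(1), of n] x(1) by (simp add: v_def B_def C_def field_simps)
    have "v / B = (real n + 2) / (x + 1) * d (Suc n) + (real n + x + 3) / (x + 1)"
      unfolding d by (subst v) (rule *)
    then have "C / v = d (Suc n) / ((real n + 2) / (x + 1) * d (Suc n) + (real n + x + 3) / (x + 1))"
      unfolding d using pos by (metis divide_divide_eq_right nonzero_mult_div_cancel_right less_irrefl times_divide_eq_left)
    then show ?thesis
      unfolding x(2,3) x_def[symmetric] by (simp add: v_def C_def)
  qed
  have d: "(\<lambda>n. d (Suc n)) \<longlonglongrightarrow> sqrt 2 - 1"
    using J_diagonal_quotient_tendsto[OF s] unfolding d_def by (rule LIMSEQ_Suc)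
  have "(\<lambda>n. (real n + 2) / (real n + s + 1)) \<longlonglongrightarrow> 1"
       "(\<lambda>n. (2 * real n + s + 3) / (real n + s + 1)) \<longlonglongrightarrow> 2"
    by real_asymp+
  note lim = this
  have "(\<lambda>n. J (Suc (Suc n)) (real (Suc n) + s) / J (Suc n) (real n + s))
    \<longlonglongrightarrow> (sqrt 2 - 1) / (1 * (sqrt 2 - 1) + 2)"
    unfolding eq by (intro tendsto_intros d lim) (simp add: add_nonneg_eq_0_iff)
  also have "(sqrt 2 - 1) / (1 * (sqrt 2 - 1) + 2) = 3 - 2 * sqrt 2"
    by (simp add: add_nonneg_eq_0_iff field_simps)
  finally show ?thesis .
qed

text \<open>Write the ratio as \<open>(C / B) * (B / v)\<close>: \<open>C / B\<close> is
  \<open>h (Suc n)\<close>, and \<open>Q_shift\<close> makes \<open>B / v\<close> an affine function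
  of \<open>1 / h n\<close>.\<close>

lemma Q_diagonal_ratio_tendsto:
  fixes s :: real
  assumes s: "s > 0"
  shows "(\<lambda>n. Q (Suc (Suc n)) (real (Suc n) + s) / Q (Suc n) (real n + s)) \<longlonglongrightarrow> 3 + 2 * sqrt 2"
proof -
  define h where "h n = Q (Suc n) (real n + s) / Q n (real n + s)" for n
  have eq: "Q (Suc (Suc n)) (real (Suc n) + s) / Q (Suc n) (real n + s)
    = h (Suc n) * ((real n + 1) / (real n + s + 1) / h n + (2 * real n + s + 2) / (real n + s + 1))"
    for n
  proof -
    define x where "x = real n + s"
    define u v B C where "u = Q n x" and "v = Q (Suc n) x"
      and "B = Q (Suc n) (x + 1)" and "C = Q (Suc (Suc n)) (x + 1)"
    have x: "x > 0" "real (Suc n) + s = x + 1" "2 * real n + s = real n + x"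
      using s by (auto simp: x_def add_nonneg_pos)
    have pos: "u > 0" "v > 0" "B > 0"
      using x Q_ge_1[of x n] Q_ge_1[of x "Suc n"] Q_ge_1[of "x + 1" "Suc n"]
      by (auto simp: u_def v_def B_def)
    have h: "h n = v / u" "h (Suc n) = C / B"
      unfolding h_def x(2) by (simp_all add: x_def u_def v_def B_def C_def)
    have *: "((a * u + b * v) / t) / v = a / t / (v / u) + b / t" for a b t
      using pos(2) by (simp add: add_divide_distrib)
    have B: "B = ((real n + 1) * u + (real n + x + 2) * v) / (x + 1)"
      using Q_shift[OF x(1), of n] x(1) by (simp add: u_def v_def B_def field_simps)
    have "B / v = (real n + 1) / (x + 1) / h n + (real n + x + 2) / (x + 1)"
      unfolding h by (subst B) (rule *)
    moreover have "C / v = h (Suc n) * (B / v)"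
      unfolding h using pos by simp
    ultimately show ?thesis
      unfolding x(2,3) x_def[symmetric] by (simp add: v_def C_def)
  qed
  have h: "h \<longlonglongrightarrow> 1 + sqrt 2"
    using Q_diagonal_quotient_tendsto[OF s] unfolding h_def .
  have "(\<lambda>n. (real n + 1) / (real n + s + 1)) \<longlonglongrightarrow> 1"
       "(\<lambda>n. (2 * real n + s + 2) / (real n + s + 1)) \<longlonglongrightarrow> 2"
    by real_asymp+
  note lim = this
  have "(\<lambda>n. Q (Suc (Suc n)) (real (Suc n) + s) / Q (Suc n) (real n + s))
    \<longlonglongrightarrow> (1 + sqrt 2) * (1 / (1 + sqrt 2) + 2)"
    unfolding eq by (intro tendsto_intros h LIMSEQ_Suc[OF h] lim) (simp add: add_nonneg_eq_0_iff)
  also have "(1 + sqrt 2) * (1 / (1 + sqrt 2) + 2) = 3 + 2 * sqrt 2"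
    by (simp add: add_nonneg_eq_0_iff field_simps)
  finally show ?thesis .
qed

section \<open>The rate \<open>17 - 12 * sqrt 2\<close> and its comparison with powers of
  \<open>e\<close>\<close>

theorem mainTheorem5:
  fixes p q :: nat
  assumes "p > 0" and "q > 0"
  shows "\<exists>\<chi>. converges_linearly_with_rate (w p q) (S_series p q) \<chi> \<and>
           1 / (9 * (exp 1)\<^sup>2) < \<chi> \<and> \<chi> < 1 / (4 * (exp 1)\<^sup>2)"
proof -
  define s where "s = real q / real p"
  define v where "v n = J (Suc n) (real n + s)" for n
  define r where "r n = Q (Suc n) (real n + s)" for n
  have s: "s > 0"
    using assms by (simp add: s_def)
  have x: "real n + s > 0" for n
    using s by (simp add: add_nonneg_pos)
  have v: "v n > 0" "v n \<le> 1 / (real n + s + 1)" for n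
    unfolding v_def using J_pos[OF x] J_le[OF x] by auto
  have r: "r n \<ge> 1" for n
    unfolding r_def using Q_ge_1 x less_imp_le by blast
  then have r0: "r n > 0" for n
    by (rule less_le_trans[OF zero_less_one])
  have error: "w p q n - S_series p q = - (v n / (real p * r n))" for n
    using w_error[OF assms, of n] by (simp add: v_def r_def s_def)
  have "(\<lambda>n. w p q n - S_series p q) \<longlonglongrightarrow> 0"
  proof (rule Lim_null_comparison)
    show "\<forall>\<^sub>F n in sequentially. norm (w p q n - S_series p q) \<le> 1 / (real n + s + 1)"
    proof (intro always_eventually allI)
      fix n
      have "1 * 1 \<le> real p * r n"
        using assms r by (intro mult_mono) auto
      then have "v n / (real p * r n) \<le> v n / 1"
        using v(1)[of n] by (intro divide_left_mono) auto
      then show "norm (w p q n - S_series p q) \<le> 1 / (real n + s + 1)"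
        using v[of n] r0[of n] unfolding error by simp
    qed
    show "(\<lambda>n. 1 / (real n + s + 1)) \<longlonglongrightarrow> 0"
      by real_asymp
  qed
  then have lim: "w p q \<longlonglongrightarrow> S_series p q"
    by (rule LIM_zero_cancel)
  have neq: "w p q n \<noteq> S_series p q" for n
    using error[of n] v(1)[of n] r0[of n] assms(1) by auto
  have "(\<lambda>n. (v (Suc n) / v n) / (r (Suc n) / r n)) \<longlonglongrightarrow> (3 - 2 * sqrt 2) / (3 + 2 * sqrt 2)"
    unfolding v_def r_def
    by (intro tendsto_divide J_diagonal_ratio_tendsto Q_diagonal_ratio_tendsto s)
       (simp add: add_nonneg_eq_0_iff)
  \<comment> \<open>The product of \<open>3 - 2 * sqrt 2\<close> and \<open>3 + 2 * sqrt 2\<close>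
    is 1, so the quotient is \<open>(3 - 2 * sqrt 2)^2\<close>.\<close>
  also have "(3 - 2 * sqrt 2) / (3 + 2 * sqrt 2) = 17 - 12 * sqrt 2"
    by (simp add: add_nonneg_eq_0_iff field_simps)
  \<comment> \<open>The common factor \<open>- 1 / p\<close> of consecutive errors cancels, and what
    remains is positive.\<close>
  also have "(\<lambda>n. (v (Suc n) / v n) / (r (Suc n) / r n))
      = (\<lambda>n. \<bar>(w p q (Suc n) - S_series p q) / (w p q n - S_series p q)\<bar>)"
    unfolding error using v(1) r0 assms(1) by (simp add: fun_eq_iff abs_mult less_imp_le)
  finally have ratio: "(\<lambda>n. \<bar>(w p q (Suc n) - S_series p q) / (w p q n - S_series p q)\<bar>)
    \<longlonglongrightarrow> 17 - 12 * sqrt 2" .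
  \<comment> \<open>Crude bounds suffice: \<open>e \<ge> 2\<close> gives
    \<open>1/36 < 0.0284\<close> on the lower side, and \<open>2.72^2 = 7.3984 < 7.4\<close> gives
    \<open>1/29.6 > 0.032\<close> on the upper side.\<close>
  have e: "2 \<le> exp (1::real)" "exp (1::real) < 2.72"
    using exp_ge_add_one_self[of 1] e_less_272 by auto
  have "2\<^sup>2 \<le> (exp (1::real))\<^sup>2" "(exp (1::real))\<^sup>2 \<le> 2.72\<^sup>2"
    using e by (intro power_mono; simp)+
  then have e2: "4 \<le> (exp (1::real))\<^sup>2" "(exp (1::real))\<^sup>2 \<le> 7.4"
    by (simp_all add: power2_eq_square)
  have "1 / (9 * (exp 1)\<^sup>2) \<le> 1 / (9 * 4 :: real)"
    using e2 by (intro divide_left_mono) auto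
  also have "\<dots> < 17 - 12 * sqrt 2"
    using sqrt_2_bounds by simp
  finally have lower: "1 / (9 * (exp 1)\<^sup>2) < 17 - 12 * sqrt 2" .
  have "17 - 12 * sqrt 2 < 1 / (4 * 7.4)"
    using sqrt_2_bounds by simp
  also have "\<dots> \<le> 1 / (4 * (exp 1)\<^sup>2)"
    using e2 by (intro divide_left_mono) auto
  finally have upper: "17 - 12 * sqrt 2 < 1 / (4 * (exp 1)\<^sup>2)" .
  have "converges_linearly_with_rate (w p q) (S_series p q) (17 - 12 * sqrt 2)"
    unfolding converges_linearly_with_rate_def has_convergence_rate_def
    using lim neq ratio sqrt_2_bounds by auto
  with lower upper show ?thesis
    by blast
qed

end
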